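(* Let $C$ be a compact set in $\mathbb{R}^d$ with positive thickness $\tau:=\tau(C)>0$, let $E$ be the unbounded component of $\mathbb{R}^d\setminus C$ (the union of the two unbounded components when $d=1$), and let $B$ be a ball such that $B\cap E=\emptyset$. Put $\beta:=\min\big\{\frac14,\frac{\operatorname{diam}(B)}{\operatorname{diam}(C)}\big\}$. If there exists $c\in(0,d)$ such that $$\tau^{-c}\le\frac1{K_2}\,\beta^c(1-\beta^{d-c}),$$ then $$\dim_H(C)\ \ge\ \dim_H(B\cap C)\ \ge\ d-K_1\,\frac{\tau^{-d}}{\beta^d\,|\log(\beta)|}\ >\ 0.$$
   Context: $\dim_H$ denotes Hausdorff dimension, $\operatorname{dist}$ Euclidean distance, $\log$ the natural logarithm. The constants are $$K_1:=\frac{2d(24\sqrt d)^d\log(16\sqrt d)}{1-2^{-d}},\qquad K_2:=\bigg(\frac{(24\sqrt d)^d(1+4^d\cdot 2)}{1-2^{-d}}\bigg)^2 .$$ Thickness in $\mathbb{R}^d$ ($d\ge1$). For a compact set $C\subset\mathbb{R}^d$, let $(G_n)_n$ be the (at most countably many, possibly finitely many) bounded open path-connected components of $\mathbb{R}^d\setminus C$, ordered by non-increasing diameter (the order among equal diameters is irrelevant), and let $E$ be the unbounded open path-connected component of $\mathbb{R}^d\setminus C$ (when $d=1$, $E$ is the union of the two unbounded intervals). If $E$ is not the only component of $\mathbb{R}^d\setminus C$, the thickness of $C$ is $$\tau(C):=\inf_n\frac{\operatorname{dist}\big(G_n,\ \bigcup_{1\le i\le n-1}G_i\cup E\big)}{\operatorname{diam}(G_n)},$$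 the infimum being over the index set of the $G_n$. If $E$ is the only component, $\tau(C):=+\infty$ when $C$ has non-empty interior and $\tau(C):=0$ when $C$ has empty interior. So $\tau(C)\in[0,+\infty]$, and $(+\infty)^{-c}=0$. *)

theory Defs
  imports "HOL-Analysis.Analysis"
begin

section \<open>Hausdorff dimension\<close>

text \<open>
  \<^term>\<open>diameter U\<close> is only meaningful for bounded \<open>U\<close>, hence the boundedness requirement on covers.
  Countable and finite covers are both captured by sequences, since members may be empty
  (an empty set contributes 0).  Only exponents \<open>s > 0\<close> are used below, so the value of
  \<^term>\<open>(0::real) powr 0\<close> plays no role.
\<close>

definition hausdorff_premeasure :: "real \<Rightarrow> real \<Rightarrow> 'a::metric_space set \<Rightarrow> ennreal" where
  "hausdorff_premeasure s \<delta> A =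
     (INF U \<in> {U :: nat \<Rightarrow> 'a set. A \<subseteq> (\<Union>i. U i) \<and> (\<forall>i. bounded (U i) \<and> diameter (U i) \<le> \<delta>)}.
        \<Sum>i. ennreal (diameter (U i) powr s))"

definition hausdorff_measure :: "real \<Rightarrow> 'a::metric_space set \<Rightarrow> ennreal" where
  "hausdorff_measure s A = (SUP \<delta> \<in> {0<..}. hausdorff_premeasure s \<delta> A)"

definition hausdorff_dim :: "'a::metric_space set \<Rightarrow> ereal" where
  "hausdorff_dim A = (INF s \<in> {s. 0 < s \<and> hausdorff_measure s A = 0}. ereal s)"

section \<open>Thickness\<close>

definition complement_components :: "'a::euclidean_space set \<Rightarrow> 'a set set" where
  "complement_components C = path_component_set (- C) ` (- C)"

definition gaps :: "'a::euclidean_space set \<Rightarrow> 'a set set" where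
  "gaps C = {G \<in> complement_components C. bounded G}"

text \<open>
  For compact \<open>C\<close> this is the unique unbounded component in dimension at least 2, and the union
  of the unbounded components in dimension 1.
\<close>

definition exterior :: "'a::euclidean_space set \<Rightarrow> 'a set" where
  "exterior C = \<Union> {G \<in> complement_components C. \<not> bounded G}"

text \<open>
  \<open>G\<close> lists the gaps without repetition, by non-increasing diameter; there are \<open>N\<close> of them
  (possibly \<open>N = \<infinity>\<close>), indexed from 0.
\<close>

definition gap_enumeration :: "'a::euclidean_space set \<Rightarrow> enat \<Rightarrow> (nat \<Rightarrow> 'a set) \<Rightarrow> bool" where
  "gap_enumeration C N G \<longleftrightarrow>
     bij_betw G {n. enat n < N} (gaps C) \<and>
     (\<forall>i j. i \<le> j \<and> enat j < N \<longrightarrow> diameter (G j) \<le> diameter (G i))"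

definition enumeration_thickness ::
    "'a::euclidean_space set \<Rightarrow> enat \<Rightarrow> (nat \<Rightarrow> 'a set) \<Rightarrow> ennreal" where
  "enumeration_thickness C N G =
     (INF n \<in> {n. enat n < N}.
        ennreal (setdist (G n) ((\<Union>i<n. G i) \<union> exterior C) / diameter (G n)))"

text \<open>
  The value does not depend on the enumeration: see \<open>thickness_eq_enumeration_thickness\<close> below.
  For \<open>d \<ge> 2\<close> an enumeration need not exist.  In that case infinitely many
  gaps have diameter at least some \<open>\<epsilon> > 0\<close>; they lie in a bounded set, so their mutual distances
  come arbitrarily close to 0, and the thickness is taken to be 0.
\<close>

definition thickness :: "'a::euclidean_space set \<Rightarrow> ennreal" where
  "thickness C =
     (if gaps C = {} then (if interior C = {} then 0 else \<infinity>)
      else if \<exists>N G. gap_enumeration C N G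
      then (THE t. \<exists>N G. gap_enumeration C N G \<and> t = enumeration_thickness C N G)
      else 0)"

lemma exterior_nonempty:
  fixes C :: "'a::euclidean_space set"
  assumes "bounded C"
  shows "exterior C \<noteq> {}"
proof -
  obtain r where r: "C \<subseteq> ball 0 r" "0 < r"
    using assms bounded_subset_ballD by blast
  obtain b :: 'a where b: "b \<in> Basis"
    using nonempty_Basis by blast
  define x where "x = r *\<^sub>R b"
  have ray: "t *\<^sub>R b \<in> path_component_set (- C) x" if "r \<le> t" for t
  proof -
    have "closed_segment x (t *\<^sub>R b) \<subseteq> - C"
    proof
      fix y assume "y \<in> closed_segment x (t *\<^sub>R b)"
      then obtain u where u: "0 \<le> u" "u \<le> 1" "y = ((1 - u) * r + u * t) *\<^sub>R b"
        by (auto simp: closed_segment_def x_def algebra_simps)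
      have "(1 - u) * r + u * t \<ge> (1 - u) * r + u * r"
        using u that by (intro add_left_mono mult_left_mono) auto
      then have "r \<le> (1 - u) * r + u * t"
        by (simp add: algebra_simps)
      then have "r \<le> norm y"
        using u b by simp
      then show "y \<in> - C"
        using r by auto
    qed
    then show ?thesis
      using path_component_of_subset path_connected_segment
      by (metis ends_in_segment mem_Collect_eq path_component_def path_connected_component)
  qed
  have "\<not> bounded (path_component_set (- C) x)"
  proof
    assume "bounded (path_component_set (- C) x)"
    then obtain M where M: "\<And>y. y \<in> path_component_set (- C) x \<Longrightarrow> norm y \<le> M"
      by (auto simp: bounded_iff)
    have "norm ((max r (\<bar>M\<bar> + 1)) *\<^sub>R b) \<le> M"
      by (rule M, rule ray) simp
    then have "\<bar>max r (\<bar>M\<bar> + 1)\<bar> \<le> M"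
      using b by simp
    then show False
      by arith
  qed
  moreover have "x \<in> path_component_set (- C) x"
    using ray[of r] by (simp add: x_def)
  moreover from this have "x \<in> - C"
    using path_component_mem(1) by blast
  ultimately show ?thesis
    by (auto simp: exterior_def complement_components_def)
qed

lemma enumeration_thickness_le:
  fixes C :: "'a::euclidean_space set"
  assumes "bounded C" and G: "gap_enumeration C N G" and H: "gap_enumeration C M H"
  shows "enumeration_thickness C N G \<le> enumeration_thickness C M H"
  unfolding enumeration_thickness_def[of C M H]
proof (rule INF_greatest)
  fix k assume "k \<in> {k. enat k < M}"
  then have k: "enat k < M" by simp
  have ne: "g \<noteq> {}" if "g \<in> gaps C" for g
    using that unfolding gaps_def complement_components_def
    by (auto simp: path_component_eq_empty simp del: Collect_empty_eq)
  have Hk: "H i \<in> gaps C" if "i \<le> k" for i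
    using H k that unfolding gap_enumeration_def bij_betw_def
    by (metis (mono_tags, lifting) enat_ord_simps(1) imageI mem_Collect_eq order_le_less_trans)
  have ex: "\<exists>n. enat n < N \<and> G n = g" if "g \<in> gaps C" for g
    using G that unfolding gap_enumeration_def bij_betw_def
    by (metis (mono_tags, lifting) imageE mem_Collect_eq)
  obtain n where n: "enat n < N" "G n = H k"
    using ex Hk by blast
  let ?r = "\<lambda>n. setdist (G n) ((\<Union>i<n. G i) \<union> exterior C) / diameter (G n)"
  let ?U = "(\<Union>i<k. H i) \<union> exterior C"
  have le: "enumeration_thickness C N G \<le> ennreal (?r m)" if "enat m < N" for m
    using that unfolding enumeration_thickness_def by (auto intro: INF_lower)
  have bdd: "bounded (H k)"
    using Hk[of k] by (simp add: gaps_def)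
  have diam0: "0 \<le> diameter (H k)"
    using bdd diameter_ge_0 by blast
  have key: "enumeration_thickness C N G \<le> ennreal (dist x y / diameter (H k))"
    if x: "x \<in> H k" and y: "y \<in> ?U" for x y
  proof -
    have *: ?thesis if "y \<in> (\<Union>i<n. G i) \<union> exterior C"
    proof -
      have "?r n \<le> dist x y / diameter (H k)"
        using that x n diam0 by (auto intro!: divide_right_mono setdist_le_dist)
      then show ?thesis
        using le[OF n(1)] by (meson ennreal_leI order_trans)
    qed
    show ?thesis
    proof (cases "y \<in> exterior C")
      case True
      then show ?thesis using * by blast
    next
      case False
      then obtain i where i: "i < k" "y \<in> H i"
        using y by auto
      obtain m where m: "enat m < N" "G m = H i"
        using ex Hk i by (metis less_imp_le)
      have "H i \<noteq> H k"
        using H i k unfolding gap_enumeration_def bij_betw_def inj_on_def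
        by (metis (mono_tags, lifting) enat_ord_simps(2) less_irrefl mem_Collect_eq order_less_trans)
      then have "m \<noteq> n"
        using m n by auto
      then consider "m < n" | "n < m"
        by linarith
      then show ?thesis
      proof cases
        case 1
        then show ?thesis
          using * i m by blast
      next
        case 2
        have "diameter (H k) \<le> diameter (H i)"
          using H i k by (simp add: gap_enumeration_def)
        moreover have "diameter (G m) \<le> diameter (G n)"
          using G m(1) 2 unfolding gap_enumeration_def by (meson less_imp_le)
        ultimately have eq: "diameter (G m) = diameter (H k)"
          using m n by simp
        have "x \<in> (\<Union>i<m. G i) \<union> exterior C"
          using 2 n x by auto
        then have "?r m \<le> dist y x / diameter (H k)"
          unfolding eq using i m diam0 by (intro divide_right_mono setdist_le_dist) auto
        then show ?thesis
          using le[OF m(1)] by (metis dist_commute ennreal_leI order_trans)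
      qed
    qed
  qed
  have U: "?U \<noteq> {}"
    using exterior_nonempty[OF assms(1)] by blast
  have "H k \<noteq> {}"
    using ne Hk by blast
  show "enumeration_thickness C N G \<le> ennreal (setdist (H k) ?U / diameter (H k))"
  proof (cases "diameter (H k) = 0")
    case True
    then show ?thesis
      using key U \<open>H k \<noteq> {}\<close> by fastforce
  next
    case False
    then have pos: "0 < diameter (H k)"
      using diam0 by simp
    obtain x y where "x \<in> H k" "y \<in> ?U"
      using U \<open>H k \<noteq> {}\<close> by blast
    then have "enumeration_thickness C N G \<noteq> \<infinity>"
      using key by (metis ennreal_less_top infinity_ennreal_def leD)
    then obtain a where a: "enumeration_thickness C N G = ennreal a" "0 \<le> a"
      by (metis ennreal_cases infinity_ennreal_def)
    have "a * diameter (H k) \<le> setdist (H k) ?U"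
    proof (rule le_setdistI)
      fix x y assume "x \<in> H k" "y \<in> ?U"
      then have "ennreal a \<le> ennreal (dist x y / diameter (H k))"
        using key a by simp
      then have "a \<le> dist x y / diameter (H k)"
        using pos by simp
      then show "a * diameter (H k) \<le> dist x y"
        using pos by (simp add: field_simps)
    qed (use U \<open>H k \<noteq> {}\<close> in auto)
    then show ?thesis
      using a pos by (simp add: field_simps ennreal_leI)
  qed
qed

lemma thickness_eq_enumeration_thickness:
  fixes C :: "'a::euclidean_space set"
  assumes "bounded C" "gaps C \<noteq> {}" "gap_enumeration C N G"
  shows "thickness C = enumeration_thickness C N G"
proof -
  have "(THE t. \<exists>N G. gap_enumeration C N G \<and> t = enumeration_thickness C N G)
      = enumeration_thickness C N G"
    using assms by (intro the_equality) (auto intro!: antisym enumeration_thickness_le)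
  then show ?thesis
    using assms by (auto simp: thickness_def)
qed

text \<open>The power \<open>t\<close> to the \<open>-a\<close> for \<open>t \<in> (0,\<infinity>]\<close>, with value 0 at \<open>t = \<infinity>\<close>.\<close>

definition neg_powr :: "ennreal \<Rightarrow> real \<Rightarrow> real" where
  "neg_powr t a = (if t = \<infinity> then 0 else enn2real t powr (- a))"

section \<open>The constants\<close>

definition K1 :: "nat \<Rightarrow> real" where
  "K1 d = 2 * real d * (24 * sqrt (real d)) ^ d * ln (16 * sqrt (real d)) / (1 - 1 / 2 ^ d)"

definition K2 :: "nat \<Rightarrow> real" where
  "K2 d = ((24 * sqrt (real d)) ^ d * (1 + 4 ^ d * 2) / (1 - 1 / 2 ^ d))\<^sup>2"

end

theory Submission
  imports Defs
begin

text \<open>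
  Why the bound holds.  Write \<open>T\<close> for the thickness and \<open>d\<close> for the dimension.  Distinct gaps \<open>G\<close>,
  \<open>H\<close> are at distance at least \<open>T * min (diameter G) (diameter H)\<close>, so a cube of side \<open>l\<close> meets at
  most one gap of diameter greater than \<open>l * sqrt d / T\<close>.  Hence, as one zooms in by factors of
  two, the gaps that become relevant at one scale occupy only a proportion of order \<open>T\<close> to the
  \<open>-d\<close> of a cube, and removing them costs a dimension loss \<open>g\<close> of the same order.

  This is made precise by a potential argument (lemma \<open>uncovered_point\<close>).  If \<open>B \<inter> C\<close> had
  vanishing Hausdorff measure in a dimension below \<open>t = d - g\<close>, a cube in \<open>B\<close> would be covered by
  the gaps together with balls for which the sum of \<open>radius powr t\<close> is tiny, and finitely many of
  these sets would suffice.  To a piece \<open>A\<close> of size \<open>a\<close> and a cube \<open>Q\<close> of side \<open>l\<close> one attaches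
  the weight \<open>a powr (-g) * vol (P \<inter> Q) / l powr t\<close>, where \<open>P\<close> is a cube of side \<open>4 * a\<close> that
  surrounds \<open>A\<close>.  Among the \<open>2 ^ d\<close> half-sized subcubes of \<open>Q\<close> there is one in which the total
  weight has been multiplied by at most \<open>2 powr (-g)\<close>; the single gap that may become relevant
  adds at most \<open>g / 4\<close>, so the total weight stays at most \<open>1 / 2\<close> along a suitable nested sequence
  of cubes.  A piece whose size is first matched by the side of the cube weighs more than \<open>1 / 2\<close>,
  so the cubes of that sequence meet no piece of at least their size.  When the side falls below
  all the finitely many sizes, the cube meets no piece at all, which contradicts the covering.

  The remaining ingredients are the following.  Each gap has diameter at most
  \<open>2 * diameter C / T\<close> (lemma \<open>gap_diameter_le\<close>), which makes the gaps light at the starting scale;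
  and the hypothesis with the constant \<open>K2 d\<close> forces \<open>(T * \<beta>) ^ d \<ge> K2 d\<close>, which leaves ample room
  for the numerical requirements above with \<open>g = 12 * (8 * sqrt d) ^ d / T ^ d\<close> (lemma
  \<open>dimension_loss_bounds\<close>).  This \<open>g\<close> does not exceed the loss in the theorem.  When
  the thickness is infinite there are no gaps, and \<open>B \<inter> C\<close> is the whole ball.
\<close>

section \<open>Cubes and averaging\<close>

text \<open>
  The open axis-parallel cube with lower corner \<open>w\<close> and side \<open>l\<close>.  Open cubes make disjoint
  halves literally disjoint, so that no null sets have to be discussed.
\<close>

definition cube :: "'a::euclidean_space \<Rightarrow> real \<Rightarrow> 'a set" where
  "cube w l = {x. \<forall>b\<in>Basis. w \<bullet> b < x \<bullet> b \<and> x \<bullet> b < w \<bullet> b + l}"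

lemma cube_eq_box: "cube w l = box w (w + l *\<^sub>R One)"
  by (auto simp: cube_def mem_box inner_simps)

lemma measure_cube: "0 < l \<Longrightarrow> measure lborel (cube (w::'a::euclidean_space) l) = l ^ DIM('a)"
  by (simp add: cube_eq_box measure_lborel_box_eq inner_simps)

lemma centre_mem_cube: "0 < l \<Longrightarrow> w + (l / 2) *\<^sub>R One \<in> cube w l"
  by (simp add: cube_def inner_simps)

lemma coord_diff_cube_le:
  assumes "x \<in> cube w l" "y \<in> cube w l" "b \<in> Basis"
  shows "\<bar>(x - y) \<bullet> b\<bar> \<le> l"
proof -
  have "w \<bullet> b < x \<bullet> b \<and> x \<bullet> b < w \<bullet> b + l" "w \<bullet> b < y \<bullet> b \<and> y \<bullet> b < w \<bullet> b + l"
    using assms by (auto simp: cube_def)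
  then show ?thesis by (simp add: inner_diff_left abs_le_iff)
qed

lemma dist_le_sqrt_DIM:
  fixes x y :: "'a::euclidean_space"
  assumes "\<And>b. b \<in> Basis \<Longrightarrow> \<bar>(x - y) \<bullet> b\<bar> \<le> l"
  shows "dist x y \<le> l * sqrt (DIM('a))"
proof -
  have l: "0 \<le> l"
    using assms[OF SOME_Basis] by linarith
  have "((x - y) \<bullet> b)\<^sup>2 \<le> l\<^sup>2" if "b \<in> Basis" for b
    using assms[OF that] by (intro power2_le_iff_abs_le[THEN iffD2] l)
  then have "(\<Sum>b\<in>Basis. ((x - y) \<bullet> b)\<^sup>2) \<le> (\<Sum>b\<in>(Basis::'a set). l\<^sup>2)"
    by (intro sum_mono)
  then have "(dist x y)\<^sup>2 \<le> (l * sqrt (DIM('a)))\<^sup>2"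
    by (simp add: dist_norm power2_norm_eq_inner euclidean_inner[of "x - y" "x - y"]
        power2_eq_square[symmetric] power_mult_distrib mult.commute del: inner_diff_left)
  then show ?thesis
    by (rule power2_le_imp_le) (simp add: l)
qed

text \<open>
  Averaging: a superadditive set function takes, on one of the \<open>2 ^ d\<close> half-sized subcubes, at
  most the average value.  The coordinates are halved one at a time, each time keeping a half
  that carries at most half of the value.
\<close>

lemma subcube_below_average:
  fixes M :: "'a::euclidean_space set \<Rightarrow> real"
  assumes super: "\<And>X Y Z. X \<in> sets borel \<Longrightarrow> Y \<in> sets borel \<Longrightarrow> bounded Z \<Longrightarrow> Z \<in> sets borel \<Longrightarrow>
             X \<inter> Y = {} \<Longrightarrow> X \<union> Y \<subseteq> Z \<Longrightarrow> M X + M Y \<le> M Z"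
    and l: "0 < l"
  obtains w' where "cube w' (l / 2) \<subseteq> cube w l" "M (cube w' (l / 2)) \<le> M (cube w l) / 2 ^ DIM('a)"
proof -
  \<comment> \<open>boxes already halved in the directions \<open>S\<close>\<close>
  define D where "D S v = {x::'a. \<forall>b\<in>Basis. v \<bullet> b < x \<bullet> b \<and> x \<bullet> b < v \<bullet> b + (if b \<in> S then l / 2 else l)}" for S v
  have D_box: "D S v = box v (v + (\<Sum>b\<in>Basis. (if b \<in> S then l / 2 else l) *\<^sub>R b))" for S v
    by (intro set_eqI) (simp add: D_def mem_box inner_add_left inner_sum_left_Basis)
  have D_meas: "D S v \<in> sets borel" "bounded (D S v)" for S v
    unfolding D_box by (auto simp: bounded_box)
  have "\<exists>v. D S v \<subseteq> D {} w \<and> M (D S v) \<le> M (D {} w) / 2 ^ card S"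
    if "finite S" "S \<subseteq> Basis" for S
    using that
  proof (induction S rule: finite_induct)
    case empty
    then show ?case by auto
  next
    case (insert c S)
    then obtain v where v: "D S v \<subseteq> D {} w" "M (D S v) \<le> M (D {} w) / 2 ^ card S" by auto
    define v' where "v' = v + (l / 2) *\<^sub>R c"
    have c: "c \<in> Basis" "c \<notin> S" using insert by auto
    have v'b: "v' \<bullet> b = v \<bullet> b + (if b = c then l / 2 else 0)" if "b \<in> Basis" for b
      using that c by (simp add: v'_def inner_simps inner_Basis)
    have sub: "D (insert c S) v \<union> D (insert c S) v' \<subseteq> D S v"
    proof
      fix x assume "x \<in> D (insert c S) v \<union> D (insert c S) v'"
      then show "x \<in> D S v"
      proof
        assume x: "x \<in> D (insert c S) v"
        show ?thesis unfolding D_def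
        proof (safe, goal_cases)
          case (1 b) then show ?case using x by (auto simp: D_def)
        next
          case (2 b)
          then show ?case using x c l unfolding D_def by (cases "b = c") fastforce+
        qed
      next
        assume x: "x \<in> D (insert c S) v'"
        show ?thesis unfolding D_def
        proof (safe, goal_cases)
          case (1 b) then show ?case using x v'b[of b] c l unfolding D_def by (cases "b = c") fastforce+
        next
          case (2 b)
          then show ?case using x v'b[of b] c l unfolding D_def by (cases "b = c") fastforce+
        qed
      qed
    qed
    have disj: "D (insert c S) v \<inter> D (insert c S) v' = {}"
      using c v'b[of c] by (fastforce simp: D_def)
    have "M (D (insert c S) v) + M (D (insert c S) v') \<le> M (D S v)"
      by (intro super D_meas disj sub)
    then have "M (D (insert c S) v) \<le> M (D S v) / 2 \<or> M (D (insert c S) v') \<le> M (D S v) / 2"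
      by linarith
    moreover have "M (D S v) / 2 \<le> M (D {} w) / 2 ^ card (insert c S)"
      using v(2) insert by (simp add: field_simps)
    ultimately show ?case
      using v(1) sub by (meson Un_subset_iff order_trans)
  qed
  from this[of Basis] obtain v where "D Basis v \<subseteq> D {} w" "M (D Basis v) \<le> M (D {} w) / 2 ^ DIM('a)" by auto
  moreover have "D Basis v = cube v (l / 2)" "D {} w = cube w l"
    by (auto simp: D_def cube_def)
  ultimately show ?thesis using that by metis
qed

section \<open>The potential argument\<close>

text \<open>
  The potential argument.  The pieces \<open>A j\<close> are of two kinds: the sizes of those in \<open>I\<close> have a small
  sum of \<open>t\<close>-th powers, and those in \<open>K\<close> are individually small and separated relative to their
  sizes.  They cannot cover a cube.
\<close>

lemma uncovered_point:
  fixes A :: "'i \<Rightarrow> 'a::euclidean_space set" and p :: "'i \<Rightarrow> 'a" and a :: "'i \<Rightarrow> real"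
    and u :: 'a and l0 T g :: real
  defines "d \<equiv> DIM('a)"
  defines "t \<equiv> real d - g"
  assumes fin: "finite I" "finite K" "I \<inter> K = {}"
    and l0: "0 < l0" and T: "0 < T" and g: "0 < g" "g \<le> 1 / 2"
    and a: "\<And>j. j \<in> I \<union> K \<Longrightarrow> 0 < a j"
    and A: "\<And>j. j \<in> I \<union> K \<Longrightarrow> A j \<subseteq> cball (p j) (a j)"
    and sep: "\<And>j k x y. j \<in> K \<Longrightarrow> k \<in> K \<Longrightarrow> j \<noteq> k \<Longrightarrow> x \<in> A j \<Longrightarrow> y \<in> A k \<Longrightarrow> T * min (a j) (a k) \<le> dist x y"
    and I_small: "(\<Sum>j\<in>I. 4 ^ d * (a j / l0) powr t) \<le> 1 / 4"
    and K_small: "\<And>k. k \<in> K \<Longrightarrow> 4 ^ d * (a k / l0) powr t \<le> 1 / 4"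
    and eps: "4 ^ d * (2 * sqrt d / T) powr t \<le> g / 4"
  shows "\<not> cube u l0 \<subseteq> (\<Union>j\<in>I \<union> K. A j)"
proof
  assume cover: "cube u l0 \<subseteq> (\<Union>j\<in>I \<union> K. A j)"
  have d1: "1 \<le> d" by (simp add: d_def Suc_leI)
  have t0: "0 < t" using d1 g by (simp add: t_def)
  \<comment> \<open>\<open>P j\<close> contains every cube of side at most \<open>a j\<close> that meets \<open>A j\<close>\<close>
  define P where "P j = cbox (p j - (2 * a j) *\<^sub>R One) (p j + (2 * a j) *\<^sub>R One)" for j
  have P_mem: "x \<in> P j \<longleftrightarrow> (\<forall>b\<in>Basis. \<bar>(x - p j) \<bullet> b\<bar> \<le> 2 * a j)" for x j
    by (auto simp: P_def mem_box inner_simps abs_le_iff)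
  have P_measure: "measure lborel (P j) = (4 * a j) ^ d" if "j \<in> I \<union> K" for j
    using a[OF that] by (simp add: P_def measure_lborel_cbox_eq inner_simps d_def)
  define W where "W j Q = a j powr (- g) * measure lborel (P j \<inter> Q)" for j Q
  have W_nonneg: "0 \<le> W j Q" for j Q by (simp add: W_def)
  \<comment> \<open>the separated pieces are taken into account only once the side \<open>l\<close> is small enough for a
      cube to meet at most one of them\<close>
  define act where "act l = {j \<in> I \<union> K. j \<in> K \<longrightarrow> l * sqrt d / T < a j}" for l
  define S where "S w l = {j \<in> act l. A j \<inter> cube w l \<noteq> {}}" for w l
  define \<Phi> where "\<Phi> w l = (\<Sum>j\<in>S w l. W j (cube w l)) / l powr t" for w l
  have fin_S: "finite (S w l)" for w l
    using fin by (simp add: S_def act_def)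
  have W_le: "W j (cube w l) / l powr t \<le> 4 ^ d * (a j / l) powr t"
    if "j \<in> I \<union> K" "0 < l" for j w l
  proof -
    have "measure lborel (P j \<inter> cube w l) \<le> measure lborel (P j)"
      by (rule measure_mono_fmeasurable) (auto simp: P_def cube_eq_box)
    then have "W j (cube w l) \<le> a j powr (- g) * (4 * a j) ^ d"
      unfolding W_def using P_measure[OF that(1)] by (intro mult_left_mono) auto
    also have "\<dots> = 4 ^ d * a j powr t"
      using a[OF that(1)]
        by (simp add: t_def power_mult_distrib powr_diff powr_minus powr_realpow field_simps)
    finally show ?thesis
      using that a[OF that(1)] by (simp add: powr_divide divide_right_mono)
  qed
  have one: "j = k" if jk: "j \<in> S w l" "k \<in> S w l" "j \<in> K" "k \<in> K" for j k w l
  proof (rule ccontr)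
    assume "j \<noteq> k"
    obtain x y where x: "x \<in> A j" "x \<in> cube w l" and y: "y \<in> A k" "y \<in> cube w l"
      using jk unfolding S_def by blast
    have "T * min (a j) (a k) \<le> dist x y"
      using sep \<open>j \<noteq> k\<close> that x y by blast
    also have "\<dots> \<le> l * sqrt d"
      unfolding d_def by (intro dist_le_sqrt_DIM coord_diff_cube_le[OF x(2) y(2)])
    finally have "min (a j) (a k) \<le> l * sqrt d / T"
      using T by (simp add: field_simps)
    then show False
      using that by (auto simp: S_def act_def)
  qed
  have card_one: "(\<Sum>j\<in>S w l \<inter> K \<inter> R. f j) \<le> c"
    if "\<And>j. j \<in> S w l \<Longrightarrow> j \<in> K \<Longrightarrow> j \<in> R \<Longrightarrow> f j \<le> c" "0 \<le> c" for w l R c and f :: "'i \<Rightarrow> real"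
  proof (cases "S w l \<inter> K \<inter> R = {}")
    case False
    then obtain j where j: "j \<in> S w l \<inter> K \<inter> R" by blast
    then have "S w l \<inter> K \<inter> R = {j}" using one by blast
    moreover have "f j \<le> c" using that(1) j by blast
    ultimately show ?thesis by simp
  qed (use that in simp)
  \<comment> \<open>the property preserved along the nested cubes\<close>
  define inv where "inv w l \<longleftrightarrow> cube w l \<subseteq> cube u l0 \<and> \<Phi> w l \<le> 1 / 2 \<and>
     (\<forall>j\<in>I \<union> K. A j \<inter> cube w l \<noteq> {} \<longrightarrow> a j < l)" for w l
  have "4 ^ d * (a j / l0) powr t \<le> 1 / 4" if "j \<in> I \<union> K" for j
    using that K_small I_small fin member_le_sum[of j I "\<lambda>j. 4 ^ d * (a j / l0) powr t"] by force
  moreover have "1 \<le> 4 ^ d * (a j / l0) powr t" if "j \<in> I \<union> K" "l0 \<le> a j" for j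
  proof -
    have "1 \<le> (a j / l0) powr t"
      using that l0 t0 by (intro ge_one_powr_ge_zero) auto
    moreover have "(1::real) \<le> 4 ^ d" by simp
    ultimately show ?thesis
      using mult_mono[of 1 "4 ^ d" 1 "(a j / l0) powr t"] by simp
  qed
  ultimately have "\<forall>j\<in>I \<union> K. a j < l0"
    by (smt (verit) divide_less_eq_1_pos)
  moreover have "\<Phi> u l0 \<le> 1 / 2"
  proof -
    have "\<Phi> u l0 = (\<Sum>j\<in>S u l0 \<inter> I. W j (cube u l0) / l0 powr t) + (\<Sum>j\<in>S u l0 \<inter> K \<inter> UNIV. W j (cube u l0) / l0 powr t)"
      unfolding \<Phi>_def sum_divide_distrib
      using fin fin_S
        by (subst sum.union_disjoint[symmetric]) (auto intro!: sum.cong simp: S_def act_def)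
    moreover have "(\<Sum>j\<in>S u l0 \<inter> I. W j (cube u l0) / l0 powr t) \<le> (\<Sum>j\<in>I. 4 ^ d * (a j / l0) powr t)"
    proof -
      have "(\<Sum>j\<in>S u l0 \<inter> I. W j (cube u l0) / l0 powr t) \<le> (\<Sum>j\<in>S u l0 \<inter> I. 4 ^ d * (a j / l0) powr t)"
        using l0 by (intro sum_mono W_le) auto
      also have "\<dots> \<le> (\<Sum>j\<in>I. 4 ^ d * (a j / l0) powr t)"
        using fin by (intro sum_mono2) auto
      finally show ?thesis .
    qed
    moreover have "(\<Sum>j\<in>S u l0 \<inter> K \<inter> UNIV. W j (cube u l0) / l0 powr t) \<le> 1 / 4"
    proof (rule card_one)
      fix j assume "j \<in> K"
      then show "W j (cube u l0) / l0 powr t \<le> 1 / 4"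
        using order_trans[OF W_le[OF _ l0] K_small] by blast
    qed simp
    ultimately show ?thesis using I_small by linarith
  qed
  ultimately have inv0: "inv u l0" by (simp add: inv_def)
  have T_big: "2 * sqrt d < T"
  proof (rule ccontr)
    assume "\<not> 2 * sqrt d < T"
    then have "1 \<le> (2 * sqrt d / T) powr t"
      using T t0 by (intro ge_one_powr_ge_zero) (auto simp: field_simps)
    moreover have "(1::real) \<le> 4 ^ d" by simp
    ultimately have "1 \<le> 4 ^ d * (2 * sqrt d / T) powr t"
      using mult_mono[of 1 "4 ^ d" 1 "(2 * sqrt d / T) powr t"] by simp
    then show False using eps g by linarith
  qed
  \<comment> \<open>convexity of the exponential function on the segment from \<open>-1\<close> to \<open>0\<close>\<close>
  have half_powr: "2 powr (- g) \<le> 1 - g / 2"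
  proof -
    have "2 powr (- g) \<le> (1 - g) * 2 powr 0 + g * 2 powr (- 1)"
    proof -
      have "convex_on UNIV (\<lambda>x::real. exp (x * ln 2))"
        by (rule f''_ge0_imp_convex[where f' = "\<lambda>x. ln 2 * exp (x * ln 2)" and f'' = "\<lambda>x. ln 2 * ln 2 * exp (x * ln 2)"])
          (auto intro!: derivative_eq_intros)
      from convex_onD[OF this, of g 0 "-1"] show ?thesis
        using g by (simp add: powr_def)
    qed
    then show ?thesis by (simp add: powr_minus)
  qed
  have step: "\<exists>w'. inv w' (l / 2)" if i: "inv w l" and l: "0 < l" for w l
  proof -
    have super: "(\<Sum>j\<in>S w l. W j X) + (\<Sum>j\<in>S w l. W j Y) \<le> (\<Sum>j\<in>S w l. W j Z)"
      if XY: "X \<in> sets borel" "Y \<in> sets borel" "bounded Z" "Z \<in> sets borel" "X \<inter> Y = {}" "X \<union> Y \<subseteq> Z" for X Y Z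
    proof -
      have "W j X + W j Y \<le> W j Z" for j
      proof -
        have fm: "P j \<inter> X \<in> fmeasurable lborel" "P j \<inter> Y \<in> fmeasurable lborel" "P j \<inter> Z \<in> fmeasurable lborel"
          using XY by (auto intro!: fmeasurable_Int_fmeasurable simp: P_def)
        then have "measure lborel (P j \<inter> X) + measure lborel (P j \<inter> Y) = measure lborel ((P j \<inter> X) \<union> (P j \<inter> Y))"
          using XY by (intro measure_Union[symmetric]) (auto simp: fmeasurable_def)
        also have "\<dots> \<le> measure lborel (P j \<inter> Z)"
          using fm XY by (intro measure_mono_fmeasurable) (auto simp: fmeasurable_def)
        finally show ?thesis
          unfolding W_def distrib_left[symmetric] by (intro mult_left_mono) auto
      qed
      then show ?thesis
        unfolding sum.distrib[symmetric] by (intro sum_mono)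
    qed
    obtain w' where sub: "cube w' (l / 2) \<subseteq> cube w l"
      and avg: "(\<Sum>j\<in>S w l. W j (cube w' (l / 2))) \<le> (\<Sum>j\<in>S w l. W j (cube w l)) / 2 ^ d"
      unfolding d_def
        by (rule subcube_below_average[of "\<lambda>Q. \<Sum>j\<in>S w l. W j Q", OF super l]) (assumption | blast)+
    let ?Q = "cube w' (l / 2)"
    \<comment> \<open>\<open>S1\<close>: pieces that already counted for the larger cube; \<open>S2\<close>: the newly active one, if any\<close>
    define S1 where "S1 = S w' (l / 2) \<inter> S w l"
    define S2 where "S2 = S w' (l / 2) \<inter> K \<inter> - S w l"
    have split: "S w' (l / 2) = S1 \<union> S2"
    proof -
      have "j \<in> S w l" if "j \<in> S w' (l / 2)" "j \<notin> K" for j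
        using that sub by (auto simp: S_def act_def)
      then show ?thesis by (auto simp: S1_def S2_def)
    qed
    have "(\<Sum>j\<in>S1. W j ?Q) / (l / 2) powr t \<le> 2 powr (- g) * \<Phi> w l"
    proof -
      have "(\<Sum>j\<in>S1. W j ?Q) \<le> (\<Sum>j\<in>S w l. W j ?Q)"
        by (intro sum_mono2) (auto simp: S1_def fin_S W_nonneg)
      then have "(\<Sum>j\<in>S1. W j ?Q) / (l / 2) powr t \<le> ((\<Sum>j\<in>S w l. W j (cube w l)) / 2 ^ d) / (l / 2) powr t"
        using avg by (intro divide_right_mono) auto
      also have "\<dots> = (2 powr t / 2 ^ d) * \<Phi> w l"
        using l by (simp add: \<Phi>_def powr_divide)
      also have "2 powr t / 2 ^ d = 2 powr (- g)"
        by (simp add: t_def powr_diff powr_minus powr_realpow field_simps)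
      finally show ?thesis .
    qed
    also have "\<dots> \<le> (1 - g / 2) * (1 / 2)"
      using half_powr i g by (intro mult_mono) (auto simp: inv_def \<Phi>_def sum_nonneg W_nonneg)
    finally have old: "(\<Sum>j\<in>S1. W j ?Q) / (l / 2) powr t \<le> 1 / 2 - g / 4"
      by (simp add: algebra_simps)
    have new: "(\<Sum>j\<in>S2. W j ?Q / (l / 2) powr t) \<le> g / 4"
      unfolding S2_def
    proof (rule card_one)
      fix j assume j: "j \<in> S w' (l / 2)" "j \<in> K" "j \<in> - S w l"
      then have "a j \<le> l * sqrt d / T"
        using sub by (force simp: S_def act_def)
      then have "a j / (l / 2) \<le> 2 * sqrt d / T"
        using l T by (simp add: field_simps)
      then have "(a j / (l / 2)) powr t \<le> (2 * sqrt d / T) powr t"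
        using a j l t0 by (intro powr_mono2) (auto simp: less_imp_le)
      moreover have "W j ?Q / (l / 2) powr t \<le> 4 ^ d * (a j / (l / 2)) powr t"
        using j l by (intro W_le) auto
      ultimately have "W j ?Q / (l / 2) powr t \<le> 4 ^ d * (2 * sqrt d / T) powr t"
        by (smt (verit) mult_left_mono zero_le_power)
      then show "W j ?Q / (l / 2) powr t \<le> g / 4" using eps by linarith
    qed (use g in simp)
    have \<Phi>': "\<Phi> w' (l / 2) \<le> 1 / 2"
    proof -
      have "\<Phi> w' (l / 2) = (\<Sum>j\<in>S1. W j ?Q) / (l / 2) powr t + (\<Sum>j\<in>S2. W j ?Q / (l / 2) powr t)"
        unfolding \<Phi>_def split sum_divide_distrib
        by (rule sum.union_disjoint) (auto simp: S1_def S2_def fin_S)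
      then show ?thesis using old new by linarith
    qed
    \<comment> \<open>a piece whose size lies in \<open>[l / 2, l)\<close> would alone weigh more than \<open>1 / 2\<close>\<close>
    have "a j < l / 2" if j: "j \<in> I \<union> K" "A j \<inter> ?Q \<noteq> {}" for j
    proof (rule ccontr)
      assume "\<not> a j < l / 2"
      then have big: "l / 2 \<le> a j" by simp
      have al: "a j < l"
        using i j sub by (auto simp: inv_def)
      have "l / 2 * sqrt d / T < l / 2"
        using T_big T l by (simp add: field_simps)
      then have "l / 2 * sqrt d / T < a j" using big by linarith
      then have jS: "j \<in> S w' (l / 2)"
        using j big by (auto simp: S_def act_def)
      obtain y where y: "y \<in> A j" "y \<in> ?Q" using j by blast
      have "?Q \<subseteq> P j"
      proof
        fix x assume x: "x \<in> ?Q"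
        have "\<bar>(x - p j) \<bullet> b\<bar> \<le> 2 * a j" if b: "b \<in> Basis" for b
        proof -
          have "\<bar>(x - y) \<bullet> b\<bar> \<le> l / 2"
            by (rule coord_diff_cube_le[OF x y(2) b])
          moreover have "\<bar>(y - p j) \<bullet> b\<bar> \<le> a j"
            using Basis_le_norm[OF b, of "y - p j"] A[OF j(1)] y(1)
              by (force simp: dist_norm norm_minus_commute)
          ultimately show ?thesis using big unfolding inner_diff_left by linarith
        qed
        then show "x \<in> P j" by (simp add: P_mem)
      qed
      then have "measure lborel (P j \<inter> ?Q) = (l / 2) ^ d"
        using l by (simp add: Int_absorb1 measure_cube d_def)
      then have eq: "W j ?Q / (l / 2) powr t = a j powr (- g) * (l / 2) powr g"
        using l by (simp add: W_def t_def powr_diff powr_realpow)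
      have "1 / 2 = (1 / 2) powr (1::real)" by simp
      also have "\<dots> \<le> (1 / 2) powr g"
        using g by (intro powr_mono') auto
      also have "\<dots> < (l / (2 * a j)) powr g"
        using al l a[OF j(1)] g by (intro powr_less_mono2) (auto simp: field_simps)
      also have "\<dots> = W j ?Q / (l / 2) powr t"
        unfolding eq using l a[OF j(1)] by (simp add: powr_minus powr_divide powr_mult field_simps)
      also have "\<dots> \<le> \<Phi> w' (l / 2)"
        unfolding \<Phi>_def
          using jS fin_S by (intro divide_right_mono member_le_sum) (auto simp: W_nonneg)
      finally show False using \<Phi>' by simp
    qed
    then have "inv w' (l / 2)"
      using i sub \<Phi>' unfolding inv_def by blast
    then show ?thesis by blast
  qed
  have all: "\<exists>w. inv w (l0 / 2 ^ n)" for n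
  proof (induction n)
    case 0 then show ?case using inv0 by auto
  next
    case (Suc n) then show ?case using step[of _ "l0 / 2 ^ n"] l0 by (auto simp: field_simps)
  qed
  have "I \<union> K \<noteq> {}"
    using cover centre_mem_cube[OF l0, of u] by blast
  define m where "m = Min (a ` (I \<union> K))"
  have fin_a: "finite (a ` (I \<union> K))" using fin by simp
  have m: "0 < m"
    unfolding m_def using fin_a \<open>I \<union> K \<noteq> {}\<close> a by (subst Min_gr_iff) auto
  have m_le: "m \<le> a j" if "j \<in> I \<union> K" for j
    unfolding m_def using fin_a that by (intro Min_le imageI)
  obtain n where "l0 / m < 2 ^ n"
    using real_arch_pow[of 2 "l0 / m"] by auto
  then have n: "l0 / 2 ^ n < m" using m by (simp add: field_simps)
  obtain w where w: "inv w (l0 / 2 ^ n)" using all by blast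
  obtain x where "x \<in> cube w (l0 / 2 ^ n)"
    using centre_mem_cube[of "l0 / 2 ^ n" w] l0 by auto
  then obtain j where "j \<in> I \<union> K" "x \<in> A j"
    using cover w unfolding inv_def by blast
  then show False
    using w m_le[of j] n \<open>x \<in> cube w (l0 / 2 ^ n)\<close> by (force simp: inv_def)
qed

section \<open>Hausdorff dimension of the complement of a sparse family\<close>

lemma hausdorff_dim_mono:
  assumes "X \<subseteq> Y"
  shows "hausdorff_dim X \<le> hausdorff_dim Y"
proof -
  have "hausdorff_premeasure s \<delta> X \<le> hausdorff_premeasure s \<delta> Y" for s \<delta>
    unfolding hausdorff_premeasure_def using assms by (intro INF_superset_mono) auto
  then have le: "hausdorff_measure s X \<le> hausdorff_measure s Y" for s
    unfolding hausdorff_measure_def by (intro SUP_mono) auto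
  have "hausdorff_measure s X = 0" if "hausdorff_measure s Y = 0" for s
    using le[of s] that by simp
  then show ?thesis
    unfolding hausdorff_dim_def by (intro INF_superset_mono) auto
qed

lemma null_set_cover:
  assumes "hausdorff_measure s X = 0" and e: "0 < e"
  obtains U where "X \<subseteq> (\<Union>i. U i)" "\<And>i. bounded (U i)" "\<And>i::nat. diameter (U i) \<le> 1"
    "(\<Sum>i. ennreal (diameter (U i) powr s)) < ennreal e"
proof -
  have "hausdorff_premeasure s 1 X \<le> hausdorff_measure s X"
    unfolding hausdorff_measure_def by (intro SUP_upper) auto
  then have "hausdorff_premeasure s 1 X < ennreal e"
    using assms by simp
  then show ?thesis
    unfolding hausdorff_premeasure_def INF_less_iff using that by blast
qed

lemma hausdorff_dim_geI:
  assumes "\<And>s. 0 < s \<Longrightarrow> hausdorff_measure s X = 0 \<Longrightarrow> D \<le> s"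
  shows "ereal D \<le> hausdorff_dim X"
  unfolding hausdorff_dim_def
proof (rule INF_greatest)
  fix s assume "s \<in> {s. 0 < s \<and> hausdorff_measure s X = 0}"
  then show "ereal D \<le> ereal s" using assms[of s] by simp
qed

lemma diameter_pos_open:
  fixes G :: "'a::euclidean_space set"
  assumes "open G" "bounded G" "G \<noteq> {}"
  shows "0 < diameter G"
proof -
  obtain x e where xe: "0 < e" "ball x e \<subseteq> G"
    using assms by (meson ex_in_conv openE)
  then have "diameter (ball x e) \<le> diameter G"
    using assms diameter_subset by blast
  then show ?thesis using xe by simp
qed

text \<open>Room for replacing a set of diameter \<open>x\<close>, possibly 0, by an open ball of slightly larger radius.\<close>

lemma powr_room:
  fixes x t e :: real
  assumes "0 \<le> x" "0 < t" "0 < e"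
  obtains y where "x < y" "y powr t = x powr t + e"
proof
  show "((x powr t + e) powr (1 / t)) powr t = x powr t + e"
    using assms by (simp add: powr_powr add_nonneg_nonneg)
  have "x = (x powr t) powr (1 / t)"
    using assms by (simp add: powr_powr)
  also have "\<dots> < (x powr t + e) powr (1 / t)"
    using assms by (intro powr_less_mono2) auto
  finally show "x < (x powr t + e) powr (1 / t)" .
qed

text \<open>
  What remains of a cube after deleting a sparse family \<open>\<G>\<close> of open sets has dimension at least
  \<open>t\<close>.  A cover witnessing a null measure is enlarged to a cover by open balls; compactness of the
  closed cube then leaves finitely many pieces.
\<close>

lemma hausdorff_dim_ge_off_sparse:
  fixes \<G> :: "'a::euclidean_space set set" and X :: "'a set" and u :: 'a and l T g :: real
  defines "d \<equiv> DIM('a)"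
  defines "t \<equiv> real d - g"
  assumes l: "0 < l" and T: "0 < T" and g: "0 < g" "g \<le> 1 / 2"
    and \<G>: "\<And>G. G \<in> \<G> \<Longrightarrow> open G \<and> bounded G \<and> G \<noteq> {}"
    and sep: "\<And>G H x y. G \<in> \<G> \<Longrightarrow> H \<in> \<G> \<Longrightarrow> G \<noteq> H \<Longrightarrow> x \<in> G \<Longrightarrow> y \<in> H
        \<Longrightarrow> T * min (diameter G) (diameter H) \<le> dist x y"
    and small: "\<And>G. G \<in> \<G> \<Longrightarrow> 4 ^ d * (diameter G / l) powr t \<le> 1 / 4"
    and eps: "4 ^ d * (2 * sqrt d / T) powr t \<le> g / 4"
    and cover: "cbox u (u + l *\<^sub>R One) \<subseteq> \<Union>\<G> \<union> X"
  shows "ereal t \<le> hausdorff_dim X"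
proof (rule hausdorff_dim_geI, rule ccontr)
  fix s assume "0 < s" and null: "hausdorff_measure s X = 0" and "\<not> t \<le> s"
  then have st: "s < t" by simp
  have t0: "0 < t" using st \<open>0 < s\<close> by simp
  \<comment> \<open>doubled by the enlargement to balls, \<open>e\<close> gives exactly the admissible weight \<open>1 / 4\<close>\<close>
  define e where "e = l powr t / (8 * 4 ^ d)"
  have e: "0 < e" using l by (simp add: e_def)
  obtain U where U: "X \<subseteq> (\<Union>i. U i)" "\<And>i. bounded (U i)" "\<And>i::nat. diameter (U i) \<le> 1"
    "(\<Sum>i. ennreal (diameter (U i) powr s)) < ennreal e"
    using null_set_cover[OF null e] by blast
  have dU: "0 \<le> diameter (U i)" for i
    using U(2) by (rule diameter_ge_0)
  have "\<exists>y. diameter (U i) < y \<and> y powr t = diameter (U i) powr t + e * (1 / 2) ^ Suc i" for i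
    using powr_room[OF dU t0, of "e * (1 / 2) ^ Suc i" i] e
      by (metis mult_pos_pos half_gt_zero_iff zero_less_one zero_less_power)
  then obtain \<rho> where \<rho>: "\<And>i. diameter (U i) < \<rho> i"
    "\<And>i. \<rho> i powr t = diameter (U i) powr t + e * (1 / 2) ^ Suc i" by metis
  have \<rho>0: "0 < \<rho> i" for i using \<rho>(1) dU by (rule le_less_trans[rotated])
  have \<rho>_sum: "(\<Sum>i\<in>F. \<rho> i powr t) \<le> 2 * e" if F: "finite F" for F
  proof -
    have "ennreal (\<Sum>i\<in>F. diameter (U i) powr s) = (\<Sum>i\<in>F. ennreal (diameter (U i) powr s))"
      by (simp add: sum_ennreal)
    also have "\<dots> \<le> (\<Sum>i. ennreal (diameter (U i) powr s))"
      using F by (intro sum_le_suminf) auto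
    also note U(4)
    finally have "(\<Sum>i\<in>F. diameter (U i) powr s) < e"
      using e by (simp add: ennreal_less_iff sum_nonneg)
    moreover have "(\<Sum>i\<in>F. diameter (U i) powr t) \<le> (\<Sum>i\<in>F. diameter (U i) powr s)"
      using st dU U(3) by (intro sum_mono powr_mono') auto
    moreover have "(\<Sum>i\<in>F. e * (1 / 2) ^ Suc i) \<le> e"
    proof -
      have "(\<Sum>i\<in>F. e * (1 / 2) ^ Suc i) \<le> (\<Sum>i. e * (1 / 2) ^ Suc i)"
        using power_half_series F e by (intro sum_le_suminf summable_mult) (auto simp: sums_iff)
      also have "\<dots> = e"
        using sums_mult[OF power_half_series, of e] by (simp add: sums_iff)
      finally show ?thesis .
    qed
    ultimately show ?thesis by (simp add: \<rho>(2) sum.distrib)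
  qed
  \<comment> \<open>pieces: the balls, indexed by \<open>Inl i\<close>, and the sets of \<open>\<G>\<close>, indexed by \<open>Inr G\<close>\<close>
  define A :: "nat + 'a set \<Rightarrow> 'a set" where "A = case_sum (\<lambda>i. ball (SOME z. z \<in> U i) (\<rho> i)) (\<lambda>G. G)"
  define p :: "nat + 'a set \<Rightarrow> 'a" where "p = case_sum (\<lambda>i. SOME z. z \<in> U i) (\<lambda>G. SOME z. z \<in> G)"
  define a :: "nat + 'a set \<Rightarrow> real" where "a = case_sum \<rho> diameter"
  let ?J = "range Inl \<union> Inr ` \<G>"
  have U_sub: "U i \<subseteq> A (Inl i)" for i
  proof
    fix x assume x: "x \<in> U i"
    then have "dist (SOME z. z \<in> U i) x \<le> diameter (U i)"
      by (intro diameter_bounded_bound U someI[of "\<lambda>z. z \<in> U i"])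
    then show "x \<in> A (Inl i)" using \<rho>(1)[of i] by (simp add: A_def)
  qed
  have "cbox u (u + l *\<^sub>R One) \<subseteq> (\<Union>j\<in>?J. A j)"
  proof
    fix x assume "x \<in> cbox u (u + l *\<^sub>R One)"
    then consider G where "G \<in> \<G>" "x \<in> G" | i where "x \<in> U i" using cover U(1) by blast
    then show "x \<in> (\<Union>j\<in>?J. A j)"
    proof cases
      case 1 then show ?thesis by (intro UN_I[of "Inr G"]) (auto simp: A_def)
    next
      case 2 then show ?thesis using U_sub by blast
    qed
  qed
  then obtain J where J: "J \<subseteq> ?J" "finite J" "cbox u (u + l *\<^sub>R One) \<subseteq> (\<Union>j\<in>J. A j)"
    by (rule compactE_image[OF compact_cbox, rotated]) (use \<G> in \<open>auto simp: A_def\<close>)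
  define I K where "I = J \<inter> range Inl" and "K = J \<inter> Inr ` \<G>"
  have JIK: "J = I \<union> K" using J(1) by (auto simp: I_def K_def)
  have "\<not> cube u l \<subseteq> (\<Union>j\<in>I \<union> K. A j)"
  proof (rule uncovered_point[where T = T and g = g and p = p and a = a and A = A and I = I and K = K])
    show "0 < a j" if "j \<in> I \<union> K" for j
    proof (cases j)
      case (Inl i) then show ?thesis by (simp add: a_def \<rho>0)
    next
      case (Inr G)
      then have "G \<in> \<G>" using that by (auto simp: I_def K_def)
      then show ?thesis using \<G>[of G] diameter_pos_open[of G] by (simp add: Inr a_def)
    qed
    show "A j \<subseteq> cball (p j) (a j)" if "j \<in> I \<union> K" for j
    proof (cases j)
      case (Inl i) then show ?thesis by (auto simp: A_def p_def a_def)
    next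
      case (Inr G)
      then have "G \<in> \<G>" using that by (auto simp: I_def K_def)
      then have G: "bounded G" "(SOME z. z \<in> G) \<in> G"
        using \<G>[of G] by (auto simp: some_in_eq)
      show ?thesis
        using diameter_bounded_bound[OF G] by (auto simp: Inr A_def p_def a_def)
    qed
    show "T * min (a j) (a k) \<le> dist x y"
      if jk: "j \<in> K" "k \<in> K" "j \<noteq> k" "x \<in> A j" "y \<in> A k" for j k x y
    proof -
      obtain G H where "j = Inr G" "k = Inr H" "G \<in> \<G>" "H \<in> \<G>"
        using jk unfolding K_def by blast
      then show ?thesis using sep[of G H x y] jk by (simp add: A_def a_def)
    qed
    show "4 ^ DIM('a) * (a k / l) powr (real DIM('a) - g) \<le> 1 / 4" if "k \<in> K" for k
      using that small by (auto simp: K_def a_def d_def t_def)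
    show "(\<Sum>j\<in>I. 4 ^ DIM('a) * (a j / l) powr (real DIM('a) - g)) \<le> 1 / 4"
    proof -
      define F where "F = Inl -` J"
      have F: "finite F" unfolding F_def by (intro finite_vimageI J) auto
      have "I = Inl ` F" by (auto simp: I_def F_def)
      then have "(\<Sum>j\<in>I. 4 ^ d * (a j / l) powr t) = (\<Sum>i\<in>F. 4 ^ d * (\<rho> i / l) powr t)"
        by (simp add: sum.reindex a_def)
      also have "\<dots> = 4 ^ d / l powr t * (\<Sum>i\<in>F. \<rho> i powr t)"
        using l \<rho>0 by (simp add: sum_distrib_left powr_divide less_imp_le)
      also have "\<dots> \<le> 4 ^ d / l powr t * (2 * e)"
        by (intro mult_left_mono \<rho>_sum F) auto
      also have "\<dots> = 1 / 4" using l by (simp add: e_def)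
      finally show ?thesis by (simp add: d_def t_def)
    qed
  qed (use J l T g eps in \<open>auto simp: I_def K_def d_def t_def\<close>)
  moreover have "cube u l \<subseteq> cbox u (u + l *\<^sub>R One)"
    unfolding cube_eq_box by (rule box_subset_cbox)
  ultimately show False using J(3) JIK by blast
qed

section \<open>Gaps of a thick compact set\<close>

text \<open>The ray from \<open>z\<close> pointing away from \<open>p\<close> never meets \<open>C\<close>.\<close>

lemma mem_exterior_outside_cball:
  fixes C :: "'a::euclidean_space set"
  assumes "C \<subseteq> cball p D" "D < dist p z"  "0 \<le> D"
  shows "z \<in> exterior C"
proof -
  define y where "y s = p + s *\<^sub>R (z - p)" for s
  have z: "0 < norm (z - p)" using assms by (auto simp: dist_norm norm_minus_commute)
  have ray: "y s \<in> path_component_set (- C) z" if "1 \<le> s" for s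
  proof -
    have "closed_segment z (y s) \<subseteq> - C"
    proof
      fix x assume "x \<in> closed_segment z (y s)"
      then obtain v where v: "0 \<le> v" "v \<le> 1" "x = (1 - v) *\<^sub>R z + v *\<^sub>R y s"
        by (auto simp: closed_segment_def)
      then have x: "x - p = (1 - v + v * s) *\<^sub>R (z - p)"
        by (simp add: y_def algebra_simps)
      have "1 \<le> 1 - v + v * s"
        using mult_left_mono[OF that v(1)] by simp
      then have "1 * norm (z - p) \<le> norm (x - p)"
        unfolding x norm_scaleR by (intro mult_right_mono) auto
      then have "D < dist p x" using assms by (simp add: dist_norm norm_minus_commute)
      then show "x \<in> - C" using assms(1) by auto
    qed
    then show ?thesis
      using path_component_of_subset path_connected_segment
      by (metis ends_in_segment mem_Collect_eq path_component_def path_connected_component)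
  qed
  have "\<not> bounded (path_component_set (- C) z)"
  proof
    assume "bounded (path_component_set (- C) z)"
    then have "\<exists>M. \<forall>x\<in>path_component_set (- C) z. dist p x \<le> M"
      by (simp only: bounded_any_center[of _ p])
    then obtain M where M: "\<And>x. x \<in> path_component_set (- C) z \<Longrightarrow> dist p x \<le> M"
      by blast
    define s where "s = 1 + \<bar>M\<bar> / norm (z - p)"
    have s: "1 \<le> s" by (simp add: s_def)
    have "dist p (y s) = s * norm (z - p)"
      using s by (simp add: y_def dist_norm)
    also have "\<dots> = norm (z - p) + \<bar>M\<bar>"
      using z by (simp add: s_def field_simps)
    finally show False using M[OF ray[OF s]] z by linarith
  qed
  moreover have "z \<in> - C" using assms by auto
  moreover from this have "z \<in> path_component_set (- C) z"
    by (simp add: path_component_refl)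
  ultimately show ?thesis
    unfolding exterior_def complement_components_def by blast
qed

lemma gap_disjoint_exterior:
  fixes C :: "'a::euclidean_space set"
  assumes "G \<in> gaps C" "z \<in> G"
  shows "z \<notin> exterior C"
proof
  assume "z \<in> exterior C"
  then obtain x y where xy: "\<not> bounded (path_component_set (- C) x)" "z \<in> path_component_set (- C) x"
     "bounded (path_component_set (- C) y)" "z \<in> path_component_set (- C) y"
    using assms unfolding exterior_def gaps_def complement_components_def by blast
  then have "path_component_set (- C) x = path_component_set (- C) z" "path_component_set (- C) y = path_component_set (- C) z"
    by (metis mem_Collect_eq path_component_eq)+
  then show False using xy by simp
qed

lemma gap_open_bounded_nonempty:
  fixes C :: "'a::euclidean_space set"
  assumes "compact C" "G \<in> gaps C"
  shows "open G \<and> bounded G \<and> G \<noteq> {}"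
proof -
  obtain z where z: "z \<in> - C" "G = path_component_set (- C) z" "bounded G"
    using assms(2) unfolding gaps_def complement_components_def by blast
  then have "z \<in> G" by (simp add: path_component_refl)
  moreover have "open G"
    unfolding z(2) using assms(1) by (intro open_path_component open_Compl compact_imp_closed)
  ultimately show ?thesis using z(3) by blast
qed

text \<open>
  A gap lies within \<open>D = diameter C\<close> of any point \<open>p\<close> of \<open>C\<close>, and points at distance just above
  \<open>D\<close> from \<open>p\<close> are exterior.
\<close>

lemma gap_diameter_le:
  fixes C :: "'a::euclidean_space set"
  assumes C: "compact C" and G: "G \<in> gaps C"
    and T: "\<And>x y. x \<in> G \<Longrightarrow> y \<in> exterior C \<Longrightarrow> T * diameter G \<le> dist x y"
  shows "T * diameter G \<le> 2 * diameter C"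
proof -
  have bC: "bounded C" using C by (rule compact_imp_bounded)
  obtain b :: 'a where b: "b \<in> Basis" using nonempty_Basis by blast
  obtain x where x: "x \<in> G" using gap_open_bounded_nonempty[OF C G] by blast
  define D where "D = diameter C"
  have D: "0 \<le> D" unfolding D_def using bC by (rule diameter_ge_0)
  \<comment> \<open>any \<open>p\<close> will do when \<open>C\<close> is empty\<close>
  obtain p where p: "C \<subseteq> cball p D"
    by (metis D_def bC diameter_bounded_bound equals0I mem_cball subsetI)
  have px: "dist p x \<le> D"
    using gap_disjoint_exterior[OF G x] mem_exterior_outside_cball[OF p _ D, of x] by fastforce
  show ?thesis
  proof (rule field_le_epsilon)
    fix e :: real assume e: "0 < e"
    define z where "z = p + (D + e) *\<^sub>R b"
    have pz: "dist p z = D + e" using D e b by (simp add: z_def dist_norm)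
    then have "z \<in> exterior C"
      using mem_exterior_outside_cball[OF p _ D] e by simp
    then have "T * diameter G \<le> dist x z" using T x by blast
    also have "\<dots> \<le> dist p x + dist p z" by (metis dist_commute dist_triangle)
    finally show "T * diameter G \<le> 2 * diameter C + e" using px pz by (simp add: D_def)
  qed
qed

text \<open>
  Thickness as a symmetric separation property, in which the enumeration of the gaps no longer
  occurs: of two gaps the one listed later has the distance bound, and it is at least as large as
  the bound with the smaller diameter.
\<close>

lemma thickness_separation:
  fixes C :: "'a::euclidean_space set"
  assumes C: "compact C" and pos: "0 < thickness C" and ne: "gaps C \<noteq> {}"
  obtains T where "0 < T" "thickness C = ennreal T"
    "\<And>G H x y. G \<in> gaps C \<Longrightarrow> H \<in> gaps C \<Longrightarrow> G \<noteq> H \<Longrightarrow> x \<in> G \<Longrightarrow> y \<in> H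
        \<Longrightarrow> T * min (diameter G) (diameter H) \<le> dist x y"
    "\<And>G x y. G \<in> gaps C \<Longrightarrow> x \<in> G \<Longrightarrow> y \<in> exterior C \<Longrightarrow> T * diameter G \<le> dist x y"
proof -
  obtain N E where E: "gap_enumeration C N E"
    using pos ne by (auto simp: thickness_def split: if_splits)
  have th: "thickness C = enumeration_thickness C N E"
    using thickness_eq_enumeration_thickness C ne E compact_imp_bounded by blast
  have ex: "\<exists>n. enat n < N \<and> E n = G" if "G \<in> gaps C" for G
    using E that unfolding gap_enumeration_def bij_betw_def
      by (metis (mono_tags, lifting) imageE mem_Collect_eq)
  have gap: "E n \<in> gaps C" if "enat n < N" for n
    using E that unfolding gap_enumeration_def bij_betw_def by blast
  have le: "thickness C \<le> ennreal (setdist (E n) ((\<Union>i<n. E i) \<union> exterior C) / diameter (E n))" if "enat n < N" for n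
    unfolding th enumeration_thickness_def using that by (intro INF_lower) auto
  obtain n where "enat n < N" using ne ex by blast
  then have "thickness C \<noteq> \<infinity>" using le[of n] by (auto simp: top_unique)
  then obtain T where T: "thickness C = ennreal T" "0 < T"
    using pos by (cases "thickness C") (auto simp: ennreal_zero_less_top)
  have key: "T * diameter (E n) \<le> dist x y"
    if n: "enat n < N" and x: "x \<in> E n" and y: "y \<in> (\<Union>i<n. E i) \<union> exterior C" for n x y
  proof -
    have d: "0 < diameter (E n)"
      using gap_open_bounded_nonempty[OF C gap[OF n]] diameter_pos_open by blast
    have "T \<le> setdist (E n) ((\<Union>i<n. E i) \<union> exterior C) / diameter (E n)"
      using le[OF n] T d by (simp add: ennreal_le_iff setdist_pos_le)
    also have "\<dots> \<le> dist x y / diameter (E n)"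
      using d x y by (intro divide_right_mono setdist_le_dist) auto
    finally show ?thesis using d by (simp add: field_simps)
  qed
  show ?thesis
  proof (rule that[OF T(2) T(1)])
    fix G x y assume "G \<in> gaps C" "x \<in> G" "y \<in> exterior C"
    then show "T * diameter G \<le> dist x y" using key ex by blast
  next
    fix G H x y assume *: "G \<in> gaps C" "H \<in> gaps C" "G \<noteq> H" "x \<in> G" "y \<in> H"
    obtain m n where mn: "enat m < N" "E m = G" "enat n < N" "E n = H" using ex * by blast
    have "T * diameter G \<le> dist x y" if "n < m"
      using key[of m x y] mn * that by auto
    moreover have "T * diameter H \<le> dist x y" if "m < n"
      using key[of n y x] mn * that by (auto simp: dist_commute)
    moreover have "m \<noteq> n" using mn * by auto
    moreover have "T * min (diameter G) (diameter H) \<le> T * diameter G" "T * min (diameter G) (diameter H) \<le> T * diameter H"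
      using T by auto
    ultimately show "T * min (diameter G) (diameter H) \<le> dist x y" by linarith
  qed
qed

section \<open>The constants and the dimension bound\<close>

text \<open>
  The arithmetic of the constants.  In the proof \<open>K2 d = R\<^sup>2\<close> and \<open>R \<ge> 9 * q\<close> with
  \<open>q = (24 * sqrt d) ^ d\<close>.  The hypothesis yields \<open>R\<^sup>2 \<le> (T * \<beta>) ^ d\<close>, hence also \<open>R\<close> as a lower bound
  for the square root of \<open>T ^ d\<close>; this half of the exponent absorbs logarithms of \<open>T\<close>.
\<close>

lemma dimension_loss_bounds:
  fixes d :: nat and T \<beta> c g :: real
  defines "g \<equiv> 12 * (8 * sqrt d) ^ d / T ^ d"
  assumes d: "1 \<le> d" and T: "0 < T" and \<beta>: "0 < \<beta>" "\<beta> \<le> 1 / 4" and c: "0 < c" "c < d"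
    and hyp: "(T * \<beta>) powr (- c) \<le> 1 / K2 d"
  shows "0 < g" "g \<le> 1 / 2"
    and "4 ^ d * (2 * sqrt d / T) powr (d - g) \<le> g / 4"
    and "4 ^ d * (4 * sqrt d / (T * \<beta>)) powr (d - g) \<le> 1 / 4"
    and "g \<le> K1 d * (T powr (- d) / (\<beta> ^ d * \<bar>ln \<beta>\<bar>))"
    and "K1 d * (T powr (- d) / (\<beta> ^ d * \<bar>ln \<beta>\<bar>)) < d"
proof -
  define s where "s = sqrt d"
  define q where "q = (24 * s) ^ d"
  define v where "v = 1 - 1 / (2::real) ^ d"
  define M where "M = 1 + 4 ^ d * (2::real)"
  define R where "R = q * M / v"
  define L where "L = ln (16 * s)"
  define X where "X = T * \<beta>"
  have s: "1 \<le> s" using d by (simp add: s_def)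
  have pow3: "3 \<le> (3::real) ^ d" and pow4: "4 \<le> (4::real) ^ d" and pow2: "2 \<le> (2::real) ^ d"
    using d by (auto intro: self_le_power)
  have q24: "24 * s \<le> q" unfolding q_def using s d by (intro self_le_power) auto
  then have q: "24 \<le> q" using s by linarith
  have q3: "3 * (8 * s) ^ d \<le> q"
  proof -
    have "24 * s = 3 * (8 * s)" by simp
    then have "q = 3 ^ d * (8 * s) ^ d" unfolding q_def by (simp only: power_mult_distrib)
    then show ?thesis using pow3 s by (simp add: mult_right_mono)
  qed
  have "8 * s = 4 * (2 * s)" "16 * s = 4 * (4 * s)" by simp_all
  then have pow8: "(8 * s) ^ d = 4 ^ d * (2 * s) ^ d" and pow16: "(16 * s) ^ d = 4 ^ d * (4 * s) ^ d"
    by (simp_all only: power_mult_distrib)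
  have v: "1 / 2 \<le> v" "v \<le> 1" using pow2 by (auto simp: v_def field_simps)
  have M: "9 \<le> M" using pow4 by (simp add: M_def)
  have R9: "9 * q \<le> R"
  proof -
    have "9 * q * v \<le> 9 * q * 1" using v q by (intro mult_left_mono) auto
    also have "\<dots> \<le> q * M" using M q by simp
    finally show ?thesis using v by (simp add: R_def field_simps)
  qed
  then have R1: "1 \<le> R" "0 < R" using q by auto
  have K2: "K2 d = R\<^sup>2" by (simp add: K2_def R_def q_def M_def v_def s_def)
  have K1: "K1 d = 2 * d * q * L / v" by (simp add: K1_def q_def L_def v_def s_def)
  have X0: "0 < X" using T \<beta> by (simp add: X_def)
  have "X powr (- c) \<le> 1 / R\<^sup>2" using hyp by (simp add: X_def K2)
  then have Xc: "R\<^sup>2 \<le> X powr c"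
    using X0 R1 by (simp add: powr_minus field_simps)
  have "1 < R\<^sup>2" using R9 q by (intro one_less_power) auto
  have X1: "1 \<le> X"
  proof (rule ccontr)
    assume "\<not> 1 \<le> X"
    then have "X powr c \<le> 1" using X0 c by (intro powr_le1) auto
    then show False using Xc \<open>1 < R\<^sup>2\<close> by linarith
  qed
  have Xd: "R\<^sup>2 \<le> X ^ d"
  proof -
    note Xc
    also have "X powr c \<le> X powr d" using X1 c by (intro powr_mono) auto
    finally show ?thesis using X0 by (simp add: powr_realpow)
  qed
  have XT: "X \<le> T" using \<beta> T by (simp add: X_def)
  then have T1: "1 \<le> T" using X1 by linarith
  have g_eq: "g = 12 * (8 * s) ^ d / T ^ d" by (simp add: g_def s_def)
  show g0: "0 < g" using s T by (simp add: g_eq)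
  have XTd: "X ^ d \<le> T ^ d" using XT X0 by (intro power_mono) auto
  have g_le: "g \<le> 4 * q / T ^ d"
    unfolding g_eq using q3 zero_le_power[of T d] T by (intro divide_right_mono) linarith+
  show g_half: "g \<le> 1 / 2"
  proof -
    have "8 * q \<le> R * R" using R9 R1 mult_mono[of 1 R "9 * q" R] q by simp
    also have "\<dots> \<le> T ^ d" using Xd XTd by (simp add: power2_eq_square)
    finally have "4 * q / T ^ d \<le> 1 / 2" using T by (simp add: field_simps)
    then show ?thesis using g_le by linarith
  qed
  have half: "z powr (d / 2) * z powr (d / 2) = z ^ d" "R\<^sup>2 \<le> z ^ d \<Longrightarrow> R \<le> z powr (d / 2)" if "0 < z" for z :: real
  proof -
    show *: "z powr (d / 2) * z powr (d / 2) = z ^ d"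
      using that by (simp add: powr_add[symmetric] powr_realpow)
    assume "R\<^sup>2 \<le> z ^ d"
    then have "R\<^sup>2 \<le> (z powr (d / 2))\<^sup>2" using * by (simp add: power2_eq_square)
    then show "R \<le> z powr (d / 2)" by (rule power2_le_imp_le) simp
  qed
  define Y where "Y = T powr (d / 2)"
  have Y: "R \<le> Y" "Y * Y = T ^ d" "0 < Y"
    using half[OF T] Xd XTd T by (auto simp: Y_def)
  \<comment> \<open>the exponent \<open>d - g\<close> may be replaced by \<open>d\<close> at the cost of a factor 3\<close>
  have Tg: "T powr g \<le> 3"
  proof -
    have "ln T * 1 \<le> ln T * d" using T1 d by (intro mult_left_mono) auto
    also have "\<dots> = 2 * ln Y" using T by (simp add: Y_def ln_powr)
    also have "\<dots> \<le> 2 * Y" using ln_less_self[OF Y(3)] by simp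
    finally have "ln T \<le> 2 * Y" by simp
    then have "g * ln T \<le> 4 * q / (Y * Y) * (2 * Y)"
      using g_le T1 q by (intro mult_mono) (auto simp: Y(2))
    also have "\<dots> = 8 * q / Y" using Y(3) by (simp add: field_simps)
    also have "\<dots> \<le> 1" using Y R9 q by (simp add: field_simps)
    finally have "exp (g * ln T) \<le> exp 1" by simp
    also have "exp 1 \<le> (3::real)" by (rule exp_le)
    finally show ?thesis using T by (simp add: powr_def)
  qed
  show "4 ^ d * (2 * sqrt d / T) powr (d - g) \<le> g / 4"
  proof -
    have "(2 * s / T) powr (d - g) = (2 * s) powr (d - g) * (T powr g / T ^ d)"
      using s T by (simp add: powr_divide powr_diff powr_realpow)
    also have "\<dots> \<le> (2 * s) powr d * (3 / T ^ d)"
      using s g0 Tg T by (intro mult_mono powr_mono divide_right_mono) auto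
    also have "\<dots> = (2 * s) ^ d * (3 / T ^ d)" using s by (simp add: powr_realpow)
    finally have "4 ^ d * (2 * s / T) powr (d - g) \<le> 4 ^ d * ((2 * s) ^ d * (3 / T ^ d))"
      by (rule mult_left_mono) simp
    also have "\<dots> = g / 4" unfolding g_eq pow8 by simp
    finally show ?thesis by (simp add: s_def)
  qed
  show "4 ^ d * (4 * sqrt d / (T * \<beta>)) powr (d - g) \<le> 1 / 4"
  proof -
    have "R \<le> X powr (d / 2)" using half(2)[OF X0 Xd] .
    also have "\<dots> \<le> X powr (d - g)" using X1 d g_half by (intro powr_mono) auto
    finally have RX: "R \<le> X powr (d - g)" .
    have "(4 * s / X) powr (d - g) = (4 * s) powr (d - g) / X powr (d - g)"
      using s X0 by (simp add: powr_divide)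
    also have "\<dots> \<le> (4 * s) powr d / R"
      using s g0 RX R1 by (intro frac_le powr_mono) auto
    also have "\<dots> = (4 * s) ^ d / R" using s by (simp add: powr_realpow)
    finally have "4 ^ d * (4 * s / X) powr (d - g) \<le> 4 ^ d * ((4 * s) ^ d / R)"
      by (rule mult_left_mono) simp
    also have "\<dots> = (16 * s) ^ d / R" unfolding pow16 by simp
    also have "\<dots> \<le> q / (9 * q)"
      unfolding q_def using s R9 q by (intro frac_le power_mono) (auto simp: q_def)
    also have "\<dots> \<le> 1 / 4" using q by simp
    finally show ?thesis by (simp add: s_def X_def)
  qed
  have ln\<beta>: "\<bar>ln \<beta>\<bar> = ln (1 / \<beta>)" using \<beta> by (simp add: ln_div)
  have L2: "2 \<le> L"
  proof -
    have "exp (2::real) = exp 1 * exp 1" by (simp add: exp_add[symmetric])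
    also have "\<dots> \<le> 3 * 3" by (intro mult_mono exp_le) auto
    finally have "exp 2 \<le> 16 * s" using s by linarith
    then show ?thesis using s by (simp add: L_def ln_ge_iff)
  qed
  have Tpow: "T powr (- d) = 1 / T ^ d" using T by (simp add: powr_minus powr_realpow inverse_eq_divide)
  show "g \<le> K1 d * (T powr (- d) / (\<beta> ^ d * \<bar>ln \<beta>\<bar>))"
  proof -
    have "\<beta> ^ d * \<bar>ln \<beta>\<bar> \<le> \<beta> ^ 1 * (1 / \<beta>)"
    proof (intro mult_mono)
      show "\<beta> ^ d \<le> \<beta> ^ 1" using \<beta> d by (intro power_decreasing) auto
      have "0 < 1 / \<beta>" using \<beta> by simp
      then show "\<bar>ln \<beta>\<bar> \<le> 1 / \<beta>"
        unfolding ln\<beta> by (intro less_imp_le ln_less_self)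
    qed (use \<beta> in auto)
    then have b1: "\<beta> ^ d * \<bar>ln \<beta>\<bar> \<le> 1" using \<beta> by simp
    have "ln \<beta> < 0" using \<beta> by simp
    then have b0: "0 < \<beta> ^ d * \<bar>ln \<beta>\<bar>"
      using \<beta>(1) by (intro mult_pos_pos) auto
    have "4 * q * v \<le> 4 * q * 1" using v q by (intro mult_left_mono) auto
    also have "4 * q * 1 \<le> 2 * d * q * L"
    proof -
      have "2 * 1 * q * 2 \<le> 2 * real d * q * L"
        using d q L2 by (intro mult_mono) auto
      then show ?thesis by simp
    qed
    finally have "4 * q \<le> K1 d" using v by (simp add: K1 field_simps)
    then have "4 * q / T ^ d \<le> K1 d * (1 / T ^ d)" using T by (simp add: divide_right_mono)
    also have "\<dots> \<le> K1 d * ((1 / T ^ d) / (\<beta> ^ d * \<bar>ln \<beta>\<bar>))"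
    proof (rule mult_left_mono)
      show "1 / T ^ d \<le> (1 / T ^ d) / (\<beta> ^ d * \<bar>ln \<beta>\<bar>)"
        using divide_left_mono[OF b1, of "1 / T ^ d"] b0 T by simp
      show "0 \<le> K1 d" using \<open>4 * q \<le> K1 d\<close> q by linarith
    qed
    finally show ?thesis using g_le Tpow by simp
  qed
  show "K1 d * (T powr (- d) / (\<beta> ^ d * \<bar>ln \<beta>\<bar>)) < d"
  proof -
    have "exp 1 \<le> (4::real)" using exp_le by linarith
    also have "\<dots> \<le> 1 / \<beta>" using \<beta> by (simp add: field_simps)
    finally have "exp 1 \<le> 1 / \<beta>" .
    then have ln1: "1 \<le> \<bar>ln \<beta>\<bar>" unfolding ln\<beta>
      using \<beta> by (simp add: ln_ge_iff)
    have "L \<le> 16 * s" unfolding L_def using s by (intro less_imp_le ln_less_self) simp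
    then have "L \<le> q" using q24 s by linarith
    have qM: "9 * q \<le> q * M" using M q by simp
    have K1_0: "0 \<le> K1 d" unfolding K1 using q L2 v by simp
    have "K1 d \<le> 2 * d * q * q / v"
      unfolding K1 using \<open>L \<le> q\<close> q v by (intro divide_right_mono mult_left_mono) auto
    also have "\<dots> < d * (9 * q) * (9 * q) / v"
    proof (rule divide_strict_right_mono)
      have "0 < d * (q * q)" using q d by simp
      then show "2 * d * q * q < d * (9 * q) * (9 * q)" by (simp add: mult_ac)
    qed (use v in simp)
    also have "\<dots> \<le> d * (q * M) * (q * M) / v"
    proof (rule divide_right_mono)
      have "(9 * q) * (9 * q) \<le> (q * M) * (q * M)"
        by (rule mult_mono[OF qM qM]) (use q M in auto)
      then show "d * (9 * q) * (9 * q) \<le> d * (q * M) * (q * M)"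
        unfolding mult.assoc[of "real d"] by (rule mult_left_mono) simp
    qed (use v in simp)
    also have "\<dots> \<le> d * (q * M) * (q * M) / (v * v)"
      using q M v by (intro divide_left_mono mult_nonneg_nonneg mult_pos_pos) (auto simp: mult_left_le)
    also have "\<dots> = d * R\<^sup>2" by (simp add: R_def power2_eq_square)
    finally have KR: "K1 d < d * R\<^sup>2" .
    have "X ^ d * 1 \<le> X ^ d * \<bar>ln \<beta>\<bar>" using ln1 X0 by (intro mult_left_mono) auto
    then have XL: "R\<^sup>2 \<le> X ^ d * \<bar>ln \<beta>\<bar>" using Xd by linarith
    have "K1 d * (T powr (- d) / (\<beta> ^ d * \<bar>ln \<beta>\<bar>)) = K1 d / (X ^ d * \<bar>ln \<beta>\<bar>)"
      unfolding Tpow X_def power_mult_distrib by simp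
    also have "\<dots> \<le> K1 d / R\<^sup>2"
      by (rule frac_le[OF K1_0 order_refl _ XL]) (use R1 in simp)
    also have "\<dots> < d" using KR R1 by (simp add: field_simps)
    finally show ?thesis .
  qed
qed

theorem corollary18:
  fixes C B :: "'a::euclidean_space set" and x :: 'a and r \<beta> :: real and \<tau> :: ennreal and d :: nat
  defines "d \<equiv> DIM('a)"
  defines "\<tau> \<equiv> thickness C"
  defines "\<beta> \<equiv> min (1 / 4) (diameter B / diameter C)"
  assumes "compact C"
    and "0 < \<tau>"
    and "0 < r" and "B = ball x r \<or> B = cball x r"
    and "B \<inter> exterior C = {}"
    and "\<exists>c. 0 < c \<and> c < real d \<and>
           neg_powr \<tau> c \<le> 1 / K2 d * (\<beta> powr c * (1 - \<beta> powr (real d - c)))"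
  shows "hausdorff_dim (B \<inter> C) \<le> hausdorff_dim C
       \<and> ereal (real d - K1 d * (neg_powr \<tau> (real d) / (\<beta> ^ d * \<bar>ln \<beta>\<bar>)))
           \<le> hausdorff_dim (B \<inter> C)
       \<and> 0 < real d - K1 d * (neg_powr \<tau> (real d) / (\<beta> ^ d * \<bar>ln \<beta>\<bar>))"
proof -
  have d: "1 \<le> d" by (simp add: d_def Suc_leI)
  \<comment> \<open>a closed cube centred at \<open>x\<close> with half-diagonal \<open>r / 2\<close>\<close>
  define l where "l = r / sqrt d"
  define u where "u = x - (l / 2) *\<^sub>R One"
  have l: "0 < l" using \<open>0 < r\<close> d by (simp add: l_def)
  have "cbox u (u + l *\<^sub>R One) \<subseteq> ball x r"
  proof
    fix y assume y: "y \<in> cbox u (u + l *\<^sub>R One)"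
    have "dist y x \<le> l / 2 * sqrt d"
      unfolding d_def
    proof (rule dist_le_sqrt_DIM)
      fix b :: 'a assume b: "b \<in> Basis"
      then have "u \<bullet> b \<le> y \<bullet> b \<and> y \<bullet> b \<le> u \<bullet> b + l"
        using y by (simp add: mem_box inner_simps)
      moreover have "u \<bullet> b = x \<bullet> b - l / 2"
        using b by (simp add: u_def inner_simps)
      ultimately show "\<bar>(y - x) \<bullet> b\<bar> \<le> l / 2"
        unfolding inner_diff_left by linarith
    qed
    also have "\<dots> < r" using \<open>0 < r\<close> d by (simp add: l_def)
    finally show "y \<in> ball x r" by (simp add: dist_commute)
  qed
  moreover have ball_B: "ball x r \<subseteq> B" using assms(7) by auto
  ultimately have cube_B: "cbox u (u + l *\<^sub>R One) \<subseteq> B" by blast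
  have "B \<subseteq> \<Union>(gaps C) \<union> C"
  proof
    fix y assume y: "y \<in> B"
    show "y \<in> \<Union>(gaps C) \<union> C"
    proof (rule ccontr)
      assume n: "y \<notin> \<Union>(gaps C) \<union> C"
      then have "y \<in> path_component_set (- C) y" "path_component_set (- C) y \<in> complement_components C"
        by (auto simp: path_component_refl complement_components_def)
      then have "y \<in> \<Union>(gaps C) \<union> exterior C"
        unfolding gaps_def exterior_def by blast
      then show False using y n assms(8) by blast
    qed
  qed
  then have cover: "cbox u (u + l *\<^sub>R One) \<subseteq> \<Union>(gaps C) \<union> (B \<inter> C)"
    using cube_B by blast
  have mono: "hausdorff_dim (B \<inter> C) \<le> hausdorff_dim C"
    by (rule hausdorff_dim_mono) simp
  have diam_B: "diameter B = 2 * r" using assms(6,7) by auto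
  show ?thesis
  proof (cases "gaps C = {}")
    case True
    have "\<tau> = \<infinity>"
      using assms(5) True by (auto simp: \<tau>_def thickness_def split: if_splits)
    then have loss: "neg_powr \<tau> d = 0" by (simp add: neg_powr_def)
    \<comment> \<open>without gaps there is nothing to delete: every loss \<open>g > 0\<close> is admissible, with \<open>T\<close> solving
        the numerical requirement with equality\<close>
    have "ereal d \<le> hausdorff_dim (B \<inter> C)"
    proof (rule ccontr)
      assume "\<not> ereal d \<le> hausdorff_dim (B \<inter> C)"
      then have "hausdorff_dim (B \<inter> C) < ereal d" by simp
      then obtain z where z: "hausdorff_dim (B \<inter> C) < ereal z" "ereal z < ereal d"
        using ereal_dense2 by blast
      define g where "g = min (1 / 2) (d - z)"
      have g: "0 < g" using z by (simp add: g_def)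
      have g_half: "g \<le> 1 / 2" unfolding g_def by (rule min.cobounded1)
      have "g \<le> d - z" unfolding g_def by (rule min.cobounded2)
      then have zg: "z \<le> d - g" by linarith
      have t: "0 < d - g" using g g_half d by linarith
      define T where "T = 2 * sqrt d * (4 ^ (d + 1) / g) powr (1 / (d - g))"
      have "(2 * sqrt d / T) powr (d - g) = g / 4 ^ (d + 1)"
        using g t d by (simp add: T_def powr_divide powr_powr)
      then have "4 ^ d * (2 * sqrt d / T) powr (d - g) \<le> g / 4" by simp
      moreover have "0 < T" using d g by (simp add: T_def)
      ultimately have "ereal (d - g) \<le> hausdorff_dim (B \<inter> C)"
        unfolding d_def using l g g_half cover True
        by (intro hausdorff_dim_ge_off_sparse[where T = T and \<G> = "{}" and u = u and l = l]) (auto simp: d_def)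
      then show False using z(1) zg by (meson ereal_less_eq(3) leD order_trans)
    qed
    then show ?thesis using mono d loss by simp
  next
    case False
    obtain T where T: "0 < T" "thickness C = ennreal T"
      and sep: "\<And>G H x y. G \<in> gaps C \<Longrightarrow> H \<in> gaps C \<Longrightarrow> G \<noteq> H \<Longrightarrow> x \<in> G \<Longrightarrow> y \<in> H
        \<Longrightarrow> T * min (diameter G) (diameter H) \<le> dist x y"
      and ext: "\<And>G x y. G \<in> gaps C \<Longrightarrow> x \<in> G \<Longrightarrow> y \<in> exterior C \<Longrightarrow> T * diameter G \<le> dist x y"
      using thickness_separation[OF assms(4) assms(5)[unfolded \<tau>_def] False] by blast
    have np: "neg_powr \<tau> a = T powr (- a)" for a
      using T by (simp add: neg_powr_def \<tau>_def)
    have gap: "open G \<and> bounded G \<and> G \<noteq> {}" if "G \<in> gaps C" for G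
      using gap_open_bounded_nonempty[OF assms(4) that] .
    have gap_pos: "0 < diameter G" if "G \<in> gaps C" for G
      using gap[OF that] diameter_pos_open by blast
    have gap_le: "T * diameter G \<le> 2 * diameter C" if "G \<in> gaps C" for G
      using gap_diameter_le[OF assms(4) that ext[OF that]] .
    obtain G0 where "G0 \<in> gaps C" using False by blast
    then have "0 < T * diameter G0" using T gap_pos by simp
    then have diam_C: "0 < diameter C" using gap_le[OF \<open>G0 \<in> gaps C\<close>] by linarith
    have \<beta>: "0 < \<beta>" "\<beta> \<le> 1 / 4" "\<beta> * diameter C \<le> 2 * r"
    proof -
      show "0 < \<beta>" "\<beta> \<le> 1 / 4" using diam_C \<open>0 < r\<close> by (auto simp: \<beta>_def diam_B)
      have "\<beta> \<le> 2 * r / diameter C" by (simp add: \<beta>_def diam_B)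
      then show "\<beta> * diameter C \<le> 2 * r" using diam_C by (simp add: field_simps)
    qed
    obtain c :: real where c: "0 < c" "c < real d"
      and hyp: "neg_powr \<tau> c \<le> 1 / K2 d * (\<beta> powr c * (1 - \<beta> powr (real d - c)))"
      using assms(9) by blast
    have "(T * \<beta>) powr (- c) \<le> 1 / K2 d"
    proof -
      have "0 \<le> K2 d" by (simp add: K2_def)
      have "T powr (- c) \<le> 1 / K2 d * (\<beta> powr c * (1 - \<beta> powr (real d - c)))"
        using hyp np by simp
      also have "\<dots> \<le> 1 / K2 d * (\<beta> powr c * 1)"
        using \<open>0 \<le> K2 d\<close> by (intro mult_left_mono) auto
      finally have "T powr (- c) * \<beta> powr (- c) \<le> 1 / K2 d * \<beta> powr c * \<beta> powr (- c)"
        by (intro mult_right_mono) auto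
      then show ?thesis
        using T \<beta> by (simp add: powr_mult powr_minus)
    qed
    note loss = dimension_loss_bounds[OF d T(1) \<beta>(1,2) c this]
    define g where "g = 12 * (8 * sqrt d) ^ d / T ^ d"
    have "ereal (d - g) \<le> hausdorff_dim (B \<inter> C)"
      unfolding d_def
    proof (rule hausdorff_dim_ge_off_sparse[where T = T and \<G> = "gaps C" and u = u and l = l])
      show "4 ^ DIM('a) * (diameter G / l) powr (real DIM('a) - g) \<le> 1 / 4" if G: "G \<in> gaps C" for G
      proof -
        have "\<beta> * (T * diameter G) \<le> \<beta> * (2 * diameter C)"
          using gap_le[OF G] \<beta>(1) by (intro mult_left_mono) auto
        then have "T * \<beta> * diameter G \<le> 4 * r" using \<beta>(3) by (simp add: algebra_simps)
        then have "diameter G \<le> 4 * r / (T * \<beta>)" using T \<beta> by (simp add: field_simps)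
        then have "diameter G / l \<le> 4 * r / (T * \<beta>) / l"
          using l by (intro divide_right_mono) auto
        also have "\<dots> = 4 * sqrt d / (T * \<beta>)"
          using \<open>0 < r\<close> by (simp add: l_def)
        finally have "(diameter G / l) powr (d - g) \<le> (4 * sqrt d / (T * \<beta>)) powr (d - g)"
          using gap_pos[OF G] l d loss(2) by (intro powr_mono2) (auto simp: g_def)
        then have "4 ^ d * (diameter G / l) powr (d - g) \<le> 4 ^ d * (4 * sqrt d / (T * \<beta>)) powr (d - g)"
          by simp
        also note loss(4)[folded g_def]
        finally show ?thesis by (simp add: d_def)
      qed
    qed (use l T(1) gap sep cover loss(1-3) in \<open>auto simp: d_def g_def\<close>)
    moreover have "ereal (d - K1 d * (neg_powr \<tau> d / (\<beta> ^ d * \<bar>ln \<beta>\<bar>))) \<le> ereal (d - g)"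
      using loss(5) by (simp add: np g_def)
    ultimately have "ereal (d - K1 d * (neg_powr \<tau> d / (\<beta> ^ d * \<bar>ln \<beta>\<bar>))) \<le> hausdorff_dim (B \<inter> C)"
      by (rule order_trans[rotated])
    then show ?thesis using mono loss(6) by (simp add: np)
  qed
qed

end
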